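(* Let $L$ be a complete, meet-continuous distributive lattice. If $F\prec G$ is a covering in $\mathrm{Fil}\,L$ which is atomic or quasi-atomic, then $F\prec G$ is regular in $\mathrm{Fil}\,L$.
   Context: A covering $x\prec y$ in a lattice is a pair $x<y$ with no element strictly between. For pairs with $x\le y$, $z\le w$, write $\langle x,y\rangle\nearrow\langle z,w\rangle$ if $y\wedge z=x$ and $y\vee z=w$; projective equivalence $\sim$ is the symmetric and transitive closure of $\nearrow$. A complete lattice $L$ is meet-continuous if $a\wedge\bigvee D=\bigvee_{d\in D}(a\wedge d)$ for all $a\in L$ and all upward directed $D\subseteq L$. A covering $x\prec y$ in a complete modular lattice is upper regular if for every nonempty chain $I$ and every family of coverings $x_i\prec y_i$ ($i\in I$), each projectively equivalent to $x\prec y$ and such that $i<j$ implies $\langle x_i,y_i\rangle\nearrow\langle x_j,y_j\rangle$, we have $\bigvee_i x_i\prec\bigvee_i y_i$. Lower regular is the dual; regular means both. A filter of $L$ is a nonempty up-closed subset closed under binary meets. $\mathrm{Fil}\,L$ is the lattice of filters ordered by reverse inclusion ($F\le G$ iff $G\subseteq F$), with $F\vee G=F\cap G$; it is complete and distributive when $L$ is. $\mathrm{Fg}\{x\}=\{z\in L: z\ge x\}$; filters of this form are principal. A maximal based filter is a pair $\langle x,H\rangle$ with $x\in L$, $H\in\mathrm{Fil}\,L$ and $\mathrm{Fg}\{x\}\prec H$. It is atomic if $H$ is principal. It is quasi-atomic if $H$ is not principal but contains an element $y$ such that $x<z\le y$ implies $z\in H$. A covering in $\mathrm{Fil}\,L$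 is atomic (resp. quasi-atomic) if it is projectively equivalent in $\mathrm{Fil}\,L$ to $\mathrm{Fg}\{x\}\prec H$ for some atomic (resp. quasi-atomic) maximal based filter $\langle x,H\rangle$. *)

theory Defs
  imports Main
begin

definition covers :: "'a::order \<Rightarrow> 'a \<Rightarrow> bool"  (infix "\<prec>" 50)
  where "x \<prec> y \<longleftrightarrow> x < y \<and> \<not> (\<exists>z. x < z \<and> z < y)"

text \<open>The two equations force \<open>x \<le> y\<close> and \<open>z \<le> w\<close>, so \<open>transposes_up\<close> relates intervals only.\<close>

definition transposes_up :: "'a::lattice \<times> 'a \<Rightarrow> 'a \<times> 'a \<Rightarrow> bool"  (infix "\<nearrow>" 50)
  where "p \<nearrow> q \<longleftrightarrow> (case (p, q) of ((x, y), (z, w)) \<Rightarrow> inf y z = x \<and> sup y z = w)"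

definition projective :: "'a::lattice \<times> 'a \<Rightarrow> 'a \<times> 'a \<Rightarrow> bool"
  where "projective = (symclp (\<nearrow>))\<^sup>+\<^sup>+"

definition upward_directed :: "'a::order set \<Rightarrow> bool"
  where "upward_directed D \<longleftrightarrow> D \<noteq> {} \<and> (\<forall>a\<in>D. \<forall>b\<in>D. \<exists>c\<in>D. a \<le> c \<and> b \<le> c)"

definition meet_continuous :: "'a::complete_lattice itself \<Rightarrow> bool"
  where "meet_continuous _ \<longleftrightarrow>
    (\<forall>(a::'a) D. upward_directed D \<longrightarrow> inf a (Sup D) = (SUP d\<in>D. inf a d))"

text \<open>
  The indexing chain is a nonempty subset of a linearly ordered type, passed as a type argument.
  To assert regularity for families indexed by arbitrary chains, leave this type variable free.
\<close>

definition upper_regular :: "'i::linorder itself \<Rightarrow> 'a::complete_lattice \<times> 'a \<Rightarrow> bool"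
  where "upper_regular _ p \<longleftrightarrow>
    (\<forall>(I::'i set) x y.
       I \<noteq> {} \<and>
       (\<forall>i\<in>I. x i \<prec> y i \<and> projective (x i, y i) p) \<and>
       (\<forall>i\<in>I. \<forall>j\<in>I. i < j \<longrightarrow> (x i, y i) \<nearrow> (x j, y j)) \<longrightarrow>
       (SUP i\<in>I. x i) \<prec> (SUP i\<in>I. y i))"

text \<open>
  In the dual lattice the pair \<open>(x, y)\<close> becomes \<open>(y, x)\<close>, and \<open>(x, y) \<nearrow> (z, w)\<close> becomes
  \<open>(w, z) \<nearrow> (y, x)\<close>; hence the reversed arrow below.
\<close>

definition lower_regular :: "'i::linorder itself \<Rightarrow> 'a::complete_lattice \<times> 'a \<Rightarrow> bool"
  where "lower_regular _ p \<longleftrightarrow>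
    (\<forall>(I::'i set) x y.
       I \<noteq> {} \<and>
       (\<forall>i\<in>I. x i \<prec> y i \<and> projective (x i, y i) p) \<and>
       (\<forall>i\<in>I. \<forall>j\<in>I. i < j \<longrightarrow> (x j, y j) \<nearrow> (x i, y i)) \<longrightarrow>
       (INF i\<in>I. x i) \<prec> (INF i\<in>I. y i))"

definition regular :: "'i::linorder itself \<Rightarrow> 'a::complete_lattice \<times> 'a \<Rightarrow> bool"
  where "regular I p \<longleftrightarrow> upper_regular I p \<and> lower_regular I p"


definition is_lattice_filter :: "'a::semilattice_inf set \<Rightarrow> bool"
  where "is_lattice_filter F \<longleftrightarrow>
    F \<noteq> {} \<and> (\<forall>a\<in>F. \<forall>b. a \<le> b \<longrightarrow> b \<in> F) \<and> (\<forall>a\<in>F. \<forall>b\<in>F. inf a b \<in> F)"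

lemma is_lattice_filter_UNIV: "is_lattice_filter UNIV"
  by (simp add: is_lattice_filter_def)

lemma is_lattice_filter_top:
  fixes F :: "'a::bounded_lattice_top set"
  shows "is_lattice_filter F \<Longrightarrow> top \<in> F"
  unfolding is_lattice_filter_def using top_greatest by blast

lemma is_lattice_filter_Inter:
  fixes S :: "'a::bounded_lattice_top set set"
  assumes "\<And>F. F \<in> S \<Longrightarrow> is_lattice_filter F"
  shows "is_lattice_filter (\<Inter>S)"
proof -
  have "top \<in> \<Inter>S"
    using assms is_lattice_filter_top by blast
  moreover have "\<forall>a\<in>\<Inter>S. \<forall>b. a \<le> b \<longrightarrow> b \<in> \<Inter>S" "\<forall>a\<in>\<Inter>S. \<forall>b\<in>\<Inter>S. inf a b \<in> \<Inter>S"
    using assms unfolding is_lattice_filter_def by blast+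
  ultimately show ?thesis
    unfolding is_lattice_filter_def by blast
qed

lemma is_lattice_filter_Int:
  fixes F :: "'a::bounded_lattice_top set"
  shows "is_lattice_filter F \<Longrightarrow> is_lattice_filter G \<Longrightarrow> is_lattice_filter (F \<inter> G)"
  using is_lattice_filter_Inter[of "{F, G}"] by auto

lemma is_lattice_filter_inf:
  fixes F :: "'a::semilattice_inf set"
  assumes F: "is_lattice_filter F" and G: "is_lattice_filter G"
  shows "is_lattice_filter {c. \<exists>a\<in>F. \<exists>b\<in>G. inf a b \<le> c}"
proof -
  have "inf c d \<in> {c. \<exists>a\<in>F. \<exists>b\<in>G. inf a b \<le> c}"
    if c: "a \<in> F" "b \<in> G" "inf a b \<le> c" and d: "a' \<in> F" "b' \<in> G" "inf a' b' \<le> d"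
    for a b c a' b' d
  proof -
    have "inf (inf a a') (inf b b') = inf (inf a b) (inf a' b')"
      by (simp add: inf.assoc inf.left_commute)
    also have "\<dots> \<le> inf c d"
      using c d by (meson inf_mono)
    finally have "inf (inf a a') (inf b b') \<le> inf c d" .
    moreover have "inf a a' \<in> F" "inf b b' \<in> G"
      using F G c d unfolding is_lattice_filter_def by blast+
    ultimately show ?thesis by blast
  qed
  moreover obtain a b where "a \<in> F" "b \<in> G"
    using F G unfolding is_lattice_filter_def by auto
  ultimately show ?thesis
    unfolding is_lattice_filter_def by (fastforce intro: order_trans)
qed

text \<open>\<open>Fil L\<close>, for \<open>L\<close> the universe of the argument type.\<close>

typedef (overloaded) 'a lattice_filter = "{F :: 'a::semilattice_inf set. is_lattice_filter F}"
  morphisms elements Abs_lattice_filter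
  using is_lattice_filter_UNIV by blast

setup_lifting type_definition_lattice_filter

instantiation lattice_filter :: (bounded_lattice_top) complete_lattice
begin

lift_definition less_eq_lattice_filter :: "'a lattice_filter \<Rightarrow> 'a lattice_filter \<Rightarrow> bool"
  is "\<lambda>F G. G \<subseteq> F" .

lift_definition less_lattice_filter :: "'a lattice_filter \<Rightarrow> 'a lattice_filter \<Rightarrow> bool"
  is "\<lambda>F G. G \<subset> F" .

lift_definition sup_lattice_filter :: "'a lattice_filter \<Rightarrow> 'a lattice_filter \<Rightarrow> 'a lattice_filter"
  is "\<lambda>F G. F \<inter> G" by (rule is_lattice_filter_Int)

lift_definition inf_lattice_filter :: "'a lattice_filter \<Rightarrow> 'a lattice_filter \<Rightarrow> 'a lattice_filter"
  is "\<lambda>F G. {c. \<exists>a\<in>F. \<exists>b\<in>G. inf a b \<le> c}" by (rule is_lattice_filter_inf)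

lift_definition Sup_lattice_filter :: "'a lattice_filter set \<Rightarrow> 'a lattice_filter"
  is "\<lambda>S. \<Inter>S" by (rule is_lattice_filter_Inter) blast

lift_definition Inf_lattice_filter :: "'a lattice_filter set \<Rightarrow> 'a lattice_filter"
  is "\<lambda>S. \<Inter>{G. is_lattice_filter G \<and> \<Union>S \<subseteq> G}" by (rule is_lattice_filter_Inter) blast

lift_definition bot_lattice_filter :: "'a lattice_filter"
  is UNIV by (rule is_lattice_filter_UNIV)

lift_definition top_lattice_filter :: "'a lattice_filter"
  is "{top}" by (auto simp: is_lattice_filter_def top_unique)

instance
proof
  fix F G H :: "'a lattice_filter" and S :: "'a lattice_filter set"
  show "(F < G) = (F \<le> G \<and> \<not> G \<le> F)"
    by transfer blast
  show "F \<le> F"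
    by transfer blast
  show "F \<le> H" if "F \<le> G" "G \<le> H"
    using that by transfer blast
  show "F = G" if "F \<le> G" "G \<le> F"
    using that by transfer blast
  show "inf F G \<le> F"
    by transfer (unfold is_lattice_filter_def, clarsimp, metis ex_in_conv inf_le1)
  show "inf F G \<le> G"
    by transfer (unfold is_lattice_filter_def, clarsimp, metis ex_in_conv inf_le2)
  show "F \<le> inf G H" if "F \<le> G" "F \<le> H"
    using that by transfer (unfold is_lattice_filter_def, blast)
  show "F \<le> sup F G" "G \<le> sup F G"
    by (transfer, blast)+
  show "sup G H \<le> F" if "G \<le> F" "H \<le> F"
    using that by transfer blast
  show "Inf S \<le> F" if "F \<in> S"
    using that by transfer blast
  show "F \<le> Inf S" if "\<And>G. G \<in> S \<Longrightarrow> F \<le> G"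
    using that by transfer blast
  show "F \<le> Sup S" if "F \<in> S"
    using that by transfer blast
  show "Sup S \<le> F" if "\<And>G. G \<in> S \<Longrightarrow> G \<le> F"
    using that by transfer blast
  show "Inf {} = (top :: 'a lattice_filter)"
  proof transfer
    have "is_lattice_filter {top :: 'a}"
      by (auto simp: is_lattice_filter_def top_unique)
    then show "\<Inter>{G :: 'a set. is_lattice_filter G \<and> \<Union>{} \<subseteq> G} = {top}"
      using is_lattice_filter_top by blast
  qed
  show "Sup {} = (bot :: 'a lattice_filter)"
    by transfer blast
qed

end

instance lattice_filter :: ("{bounded_lattice_top, distrib_lattice}") distrib_lattice
proof
  fix F G H :: "'a lattice_filter"
  have "sup (inf G H) F \<ge> inf (sup G F) (sup H F)"
  proof (transfer, rule subsetI)
    fix F G H :: "'a set" and c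
    assume F: "is_lattice_filter F" and G: "is_lattice_filter G" and H: "is_lattice_filter H"
      and "c \<in> {c. \<exists>a\<in>G. \<exists>b\<in>H. inf a b \<le> c} \<inter> F"
    then obtain a b where ab: "a \<in> G" "b \<in> H" "inf a b \<le> c" and c: "c \<in> F"
      by blast
    have "sup a c \<in> G \<inter> F" "sup b c \<in> H \<inter> F"
      using F G H ab c unfolding is_lattice_filter_def by (meson IntI sup_ge1 sup_ge2)+
    moreover have "inf (sup a c) (sup b c) \<le> c"
      using ab by (simp flip: sup_inf_distrib2)
    ultimately show "c \<in> {c. \<exists>a\<in>G \<inter> F. \<exists>b\<in>H \<inter> F. inf a b \<le> c}"
      by blast
  qed
  then show "sup F (inf G H) = inf (sup F G) (sup F H)"
    by (intro antisym) (simp_all add: sup_commute le_infI1 le_infI2)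
qed

lift_definition principal_filter :: "'a::semilattice_inf \<Rightarrow> 'a lattice_filter"
  is "\<lambda>x. {z. x \<le> z}" by (auto simp: is_lattice_filter_def intro: order_trans)

definition principal :: "'a::semilattice_inf lattice_filter \<Rightarrow> bool"
  where "principal F \<longleftrightarrow> (\<exists>x. F = principal_filter x)"

definition maximal_based_filter :: "'a::bounded_lattice_top \<times> 'a lattice_filter \<Rightarrow> bool"
  where "maximal_based_filter p \<longleftrightarrow> (case p of (x, H) \<Rightarrow> principal_filter x \<prec> H)"

definition atomic_mbf :: "'a::bounded_lattice_top \<times> 'a lattice_filter \<Rightarrow> bool"
  where "atomic_mbf p \<longleftrightarrow> maximal_based_filter p \<and> (case p of (x, H) \<Rightarrow> principal H)"

definition quasi_atomic_mbf :: "'a::bounded_lattice_top \<times> 'a lattice_filter \<Rightarrow> bool"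
  where "quasi_atomic_mbf p \<longleftrightarrow> maximal_based_filter p \<and>
    (case p of (x, H) \<Rightarrow> \<not> principal H \<and>
      (\<exists>y\<in>elements H. \<forall>z. x < z \<and> z \<le> y \<longrightarrow> z \<in> elements H))"

definition atomic_covering ::
    "'a::bounded_lattice_top lattice_filter \<times> 'a lattice_filter \<Rightarrow> bool"
  where "atomic_covering p \<longleftrightarrow>
    (\<exists>x H. atomic_mbf (x, H) \<and> projective p (principal_filter x, H))"

definition quasi_atomic_covering ::
    "'a::bounded_lattice_top lattice_filter \<times> 'a lattice_filter \<Rightarrow> bool"
  where "quasi_atomic_covering p \<longleftrightarrow>
    (\<exists>x H. quasi_atomic_mbf (x, H) \<and> projective p (principal_filter x, H))"

end

theory Submission
  imports Defs
begin

text \<open>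
  In a distributive lattice the condition \<open>inf F y \<le> x\<close> on \<open>F\<close> depends only on the projectivity
  class of \<open>(x, y)\<close>; when \<open>x \<prec> y\<close> it defines a prime ideal. Along a chain
  \<open>(x\<^sub>i, y\<^sub>i)\<close> of transposes, upper regularity says that the supremum of the \<open>x\<^sub>i\<close> stays in this
  ideal. If the class contains \<open>(Fg {a}, H)\<close> with \<open>(a, H)\<close> atomic or quasi-atomic, the ideal
  consists of the filters containing an \<open>f\<close> with \<open>inf f y \<le> a\<close>, for one fixed \<open>y\<close>. By
  meet-continuity there is a largest such \<open>f\<close>, so the ideal is closed under arbitrary suprema.
  Lower regularity holds for every covering, because the infimum of a chain of filters is its union
  and \<open>Fil L\<close> is therefore dually meet-continuous.
\<close>

section \<open>Transposed and projective intervals\<close>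

lemma transposes_up_iff: "(x, y) \<nearrow> (z, w) \<longleftrightarrow> inf y z = x \<and> sup y z = w"
  by (simp add: transposes_up_def)

text \<open>By distributivity both sides reduce to \<open>inf c y \<le> z\<close>: on the right, the
  extra joinand \<open>inf c z\<close> is below \<open>z\<close> anyway.\<close>

lemma transposes_up_inf_le_iff:
  fixes x :: "'a::distrib_lattice"
  assumes "(x, y) \<nearrow> (z, w)"
  shows "inf c y \<le> x \<longleftrightarrow> inf c w \<le> z"
proof -
  have x: "x = inf y z" and w: "w = sup y z"
    using assms by (simp_all add: transposes_up_iff)
  show ?thesis
    unfolding x w by (simp add: inf_sup_distrib1)
qed

lemma projective_inf_le_iff:
  fixes p :: "'a::distrib_lattice \<times> 'a"
  assumes "projective p q"
  shows "inf c (snd p) \<le> fst p \<longleftrightarrow> inf c (snd q) \<le> fst q"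
proof -
  have "inf c (snd p) \<le> fst p \<longleftrightarrow> inf c (snd q) \<le> fst q" if "p \<nearrow> q" for p q :: "'a \<times> 'a"
    using that by (metis prod.collapse transposes_up_inf_le_iff)
  then have step: "inf c (snd p) \<le> fst p \<longleftrightarrow> inf c (snd q) \<le> fst q"
    if "symclp (\<nearrow>) p q" for p q :: "'a \<times> 'a"
    using that unfolding symclp_def by metis
  show ?thesis
    using assms unfolding projective_def by (induction rule: tranclp_induct) (metis step)+
qed

text \<open>Joining with \<open>z\<close> and meeting with \<open>y\<close> are inverse isomorphisms
  between the intervals from \<open>x\<close> to \<open>y\<close> and from \<open>z\<close> to
  \<open>w\<close>. This carries the covering property from one member of a chain to the limit
  pair.\<close>

lemma covers_transposes_up_iff:
  fixes x :: "'a::distrib_lattice"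
  assumes "(x, y) \<nearrow> (z, w)"
  shows "x \<prec> y \<longleftrightarrow> z \<prec> w"
proof -
  have x: "x = inf y z" and w: "w = sup y z"
    using assms by (simp_all add: transposes_up_iff)
  have lt: "x < y \<longleftrightarrow> z < w"
    unfolding x w by (simp add: less_le_not_le)
  have "(\<exists>t. x < t \<and> t < y) \<longleftrightarrow> (\<exists>t. z < t \<and> t < w)"
  proof
    assume "\<exists>t. x < t \<and> t < y"
    then obtain t where t: "x < t" "t < y" by blast
    have "inf (sup t z) y = sup (inf t y) (inf y z)"
      by (simp add: inf_sup_distrib2 inf_commute[of z y])
    also have "\<dots> = t"
      using t unfolding x by (simp add: inf_absorb1 sup_absorb1 less_imp_le)
    finally have "inf (sup t z) y = t" .
    then have "sup t z \<noteq> z" "sup t z \<noteq> w"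
      using t unfolding x w by (auto simp: inf_commute inf_sup_absorb)
    moreover have "z \<le> sup t z" "sup t z \<le> w"
      using t unfolding w by (auto intro: le_supI1 sup_mono less_imp_le)
    ultimately show "\<exists>t. z < t \<and> t < w"
      by (metis order.strict_iff_order)
  next
    assume "\<exists>t. z < t \<and> t < w"
    then obtain t where t: "z < t" "t < w" by blast
    have "sup (inf t y) z = t"
      using t unfolding w by (simp add: sup_inf_distrib2 sup_absorb1 inf_absorb1 less_imp_le)
    then have "inf t y \<noteq> x" "inf t y \<noteq> y"
      using t unfolding x w by (auto simp: inf_commute sup_absorb2)
    moreover have "x \<le> inf t y" "inf t y \<le> y"
      using t unfolding x by (auto intro: le_infI2 inf_mono less_imp_le)
    ultimately show "\<exists>t. x < t \<and> t < y"
      by (metis order.strict_iff_order)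
  qed
  with lt show ?thesis
    unfolding covers_def by blast
qed

section \<open>Filters\<close>

text \<open>Two elements of the union already lie in the larger of two comparable filters, so the
  union is closed under meets and no further elements are generated.\<close>

lemma elements_Inf_chain:
  fixes S :: "'a::bounded_lattice_top lattice_filter set"
  assumes "S \<noteq> {}" and chain: "\<And>F G. F \<in> S \<Longrightarrow> G \<in> S \<Longrightarrow> F \<le> G \<or> G \<le> F"
  shows "elements (Inf S) = (\<Union>F\<in>S. elements F)"
proof -
  have filter: "is_lattice_filter (elements F)" for F :: "'a lattice_filter"
    using elements by auto
  have "is_lattice_filter (\<Union>F\<in>S. elements F)"
    unfolding is_lattice_filter_def
  proof (intro conjI ballI allI impI)
    show "(\<Union>F\<in>S. elements F) \<noteq> {}"
      using \<open>S \<noteq> {}\<close> filter unfolding is_lattice_filter_def by fastforce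
  next
    fix a b assume "a \<in> (\<Union>F\<in>S. elements F)" "a \<le> b"
    then show "b \<in> (\<Union>F\<in>S. elements F)"
      using filter unfolding is_lattice_filter_def by blast
  next
    fix c d assume "c \<in> (\<Union>F\<in>S. elements F)" "d \<in> (\<Union>F\<in>S. elements F)"
    then obtain F G where FG: "F \<in> S" "G \<in> S" and cd: "c \<in> elements F" "d \<in> elements G"
      by blast
    obtain K where K: "K \<in> S" "c \<in> elements K" "d \<in> elements K"
      using chain[OF FG] FG cd unfolding less_eq_lattice_filter.rep_eq by blast
    then have "inf c d \<in> elements K"
      using filter[of K] unfolding is_lattice_filter_def by simp
    with K(1) show "inf c d \<in> (\<Union>F\<in>S. elements F)"
      by blast
  qed
  then show ?thesis
    unfolding Inf_lattice_filter.rep_eq by blast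
qed

lemma le_principal_filter_iff: "F \<le> principal_filter a \<longleftrightarrow> a \<in> elements F"
  for F :: "'a::bounded_lattice_top lattice_filter"
proof -
  have "is_lattice_filter (elements F)"
    using elements by auto
  then show ?thesis
    unfolding less_eq_lattice_filter.rep_eq principal_filter.rep_eq is_lattice_filter_def by blast
qed

text \<open>The element of \<open>H\<close> that witnesses
  \<open>inf F H \<le> principal_filter a\<close> may vary with \<open>F\<close>; the assumption on
  \<open>y\<close> allows it to be replaced by \<open>y\<close> throughout.\<close>

lemma inf_le_principal_filter_iff:
  fixes a :: "'a::{bounded_lattice_top, distrib_lattice}"
  assumes lt: "principal_filter a < H"
    and "y \<in> elements H" and y: "\<And>z. a < z \<Longrightarrow> z \<le> y \<Longrightarrow> z \<in> elements H"
  shows "inf F H \<le> principal_filter a \<longleftrightarrow> (\<exists>f\<in>elements F. inf f y \<le> a)"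
proof
  assume "inf F H \<le> principal_filter a"
  then obtain f h where f: "f \<in> elements F" and h: "h \<in> elements H" and le: "inf f h \<le> a"
    unfolding le_principal_filter_iff inf_lattice_filter.rep_eq by blast
  have H: "is_lattice_filter (elements H)"
    using elements by auto
  have "a \<notin> elements H"
    using lt le_principal_filter_iff[of H a] by auto
  have "a \<le> y"
    using lt \<open>y \<in> elements H\<close> unfolding less_lattice_filter.rep_eq principal_filter.rep_eq by blast
  \<comment> \<open>This \<open>z\<close> lies between \<open>a\<close> and \<open>y\<close>. Were
    it strictly above \<open>a\<close>, it would belong to \<open>H\<close>, and then so would
    \<open>inf z h\<close> and hence \<open>a\<close>.\<close>
  define z where "z = sup (inf f y) a"
  have "inf z h = sup (inf (inf f h) y) (inf a h)"
    unfolding z_def by (simp add: inf_sup_distrib2 inf.assoc inf.commute[of h y])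
  also have "\<dots> \<le> a"
    using le by (simp add: le_infI1)
  finally have "z \<notin> elements H"
    using H h \<open>a \<notin> elements H\<close> unfolding is_lattice_filter_def by blast
  moreover have "z \<le> y" "a \<le> z"
    using \<open>a \<le> y\<close> by (simp_all add: z_def)
  ultimately have "z = a"
    using y by (metis order.strict_iff_order)
  then have "inf f y \<le> a"
    unfolding z_def by (metis sup_ge1)
  with f show "\<exists>f\<in>elements F. inf f y \<le> a" by blast
next
  assume "\<exists>f\<in>elements F. inf f y \<le> a"
  with \<open>y \<in> elements H\<close> show "inf F H \<le> principal_filter a"
    unfolding le_principal_filter_iff inf_lattice_filter.rep_eq by blast
qed

text \<open>The witness is the relative pseudocomplement of \<open>y\<close> with respect to \<open>a\<close>.\<close>

lemma meet_continuous_greatest_inf_le: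
  fixes a y :: "'a::{complete_lattice, distrib_lattice}"
  assumes "meet_continuous TYPE('a)"
  obtains g where "inf g y \<le> a" and "\<And>f. inf f y \<le> a \<Longrightarrow> f \<le> g"
proof
  let ?D = "{f. inf f y \<le> a}"
  have "upward_directed ?D"
    unfolding upward_directed_def
  proof (intro conjI ballI)
    have "bot \<in> ?D"
      by simp
    then show "?D \<noteq> {}"
      by blast
  next
    fix c d assume "c \<in> ?D" "d \<in> ?D"
    then have "sup c d \<in> ?D"
      by (simp add: inf_sup_distrib2)
    then show "\<exists>e\<in>?D. c \<le> e \<and> d \<le> e"
      by (intro bexI[of _ "sup c d"]) simp_all
  qed
  then have "inf y (Sup ?D) = (SUP f\<in>?D. inf y f)"
    using assms unfolding meet_continuous_def by blast
  also have "\<dots> \<le> a"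
    by (simp add: SUP_le_iff inf_commute)
  finally show "inf (Sup ?D) y \<le> a"
    by (simp add: inf_commute)
  show "f \<le> Sup ?D" if "inf f y \<le> a" for f
    using that by (simp add: Sup_upper)
qed

text \<open>The largest \<open>g\<close> with \<open>inf g y \<le> a\<close> lies above a witness
  from each \<open>F i\<close>, hence in every \<open>F i\<close>. A supremum of filters is their
  intersection, so \<open>g\<close> is a common witness.\<close>

lemma inf_SUP_le_principal_filter:
  fixes a :: "'a::{complete_lattice, distrib_lattice}"
  assumes "meet_continuous TYPE('a)"
    and "principal_filter a < H"
    and "y \<in> elements H" and "\<And>z. a < z \<Longrightarrow> z \<le> y \<Longrightarrow> z \<in> elements H"
    and F: "\<And>i. i \<in> I \<Longrightarrow> inf (F i) H \<le> principal_filter a"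
  shows "inf (SUP i\<in>I. F i) H \<le> principal_filter a"
proof -
  note iff = inf_le_principal_filter_iff[OF assms(2-4)]
  obtain g where g: "inf g y \<le> a" and greatest: "\<And>f. inf f y \<le> a \<Longrightarrow> f \<le> g"
    using meet_continuous_greatest_inf_le[OF assms(1)] by metis
  have "g \<in> elements (F i)" if i: "i \<in> I" for i
  proof -
    obtain f where "f \<in> elements (F i)" "inf f y \<le> a"
      using F[OF i] iff by blast
    then show ?thesis
      using greatest elements[of "F i"] unfolding is_lattice_filter_def by blast
  qed
  then have "g \<in> elements (SUP i\<in>I. F i)"
    unfolding Sup_lattice_filter.rep_eq by blast
  with g show ?thesis
    using iff by blast
qed

text \<open>Supplies in the atomic case the element that quasi-atomicity postulates, so that both
  cases can be treated alike. The generator of \<open>H\<close> works because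
  \<open>principal_filter\<close> is an order embedding.\<close>

lemma atomic_mbf_generator:
  assumes "atomic_mbf (a, H)"
  obtains b where "b \<in> elements H" and "\<And>z. a < z \<Longrightarrow> z \<le> b \<Longrightarrow> z \<in> elements H"
proof -
  obtain b where H: "H = principal_filter b" and cov: "principal_filter a \<prec> H"
    using assms unfolding atomic_mbf_def maximal_based_filter_def principal_def by auto
  have le_iff: "principal_filter u \<le> principal_filter v \<longleftrightarrow> u \<le> v" for u v :: 'a
    by (simp add: le_principal_filter_iff principal_filter.rep_eq)
  have "b \<le> z" if "a < z" "z \<le> b" for z
    using cov that unfolding covers_def H by (metis le_iff less_le_not_le)
  then show thesis
    using that[of b] unfolding H principal_filter.rep_eq by simp
qed

section \<open>Regularity\<close>

text \<open>Once the supremum of the \<open>x i\<close> stays in the ideal of \<open>p\<close>, any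
  single \<open>(x i, y i)\<close> transposes up to the pair of suprema, which is therefore a
  covering.\<close>

lemma upper_regularI:
  fixes p :: "'a::{complete_lattice, distrib_lattice} \<times> 'a"
  assumes "\<And>(I::'i set) x. (\<And>i. i \<in> I \<Longrightarrow> inf (x i) (snd p) \<le> fst p) \<Longrightarrow>
    inf (SUP i\<in>I. x i) (snd p) \<le> fst p"
  shows "upper_regular TYPE('i::linorder) p"
  unfolding upper_regular_def
proof (intro allI impI, elim conjE)
  fix I :: "'i set" and x y
  assume "I \<noteq> {}"
    and xy: "\<forall>i\<in>I. x i \<prec> y i \<and> projective (x i, y i) p"
    and up: "\<forall>i\<in>I. \<forall>j\<in>I. i < j \<longrightarrow> (x i, y i) \<nearrow> (x j, y j)"
  let ?X = "SUP i\<in>I. x i" and ?Y = "SUP i\<in>I. y i"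
  obtain i where i: "i \<in> I"
    using \<open>I \<noteq> {}\<close> by blast
  have ideal: "inf c (y j) \<le> x j \<longleftrightarrow> inf c (snd p) \<le> fst p" if "j \<in> I" for c j
    using projective_inf_le_iff[of "(x j, y j)" p c] xy that by simp
  have le: "x j \<le> y j" if "j \<in> I" for j
    using xy that unfolding covers_def by auto
  have "inf (x j) (snd p) \<le> fst p" if "j \<in> I" for j
    using ideal[OF that, of "x j"] by simp
  \<comment> \<open>All pairs of the chain define the same ideal as \<open>p\<close>, so membership
    of \<open>?X\<close> can be read off at the fixed index \<open>i\<close>.\<close>
  then have "inf ?X (y i) \<le> x i"
    unfolding ideal[OF i] by (rule assms)
  then have "inf (y i) ?X = x i"
    using i le[OF i] by (intro antisym) (auto simp: inf_commute intro: SUP_upper)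
  moreover have "sup (y i) ?X = ?Y"
  proof (rule antisym)
    show "sup (y i) ?X \<le> ?Y"
      using i le by (auto intro!: SUP_upper SUP_mono)
    show "?Y \<le> sup (y i) ?X"
    proof (rule SUP_least)
      fix j assume j: "j \<in> I"
      consider "j < i" | "j = i" | "i < j"
        by (rule linorder_cases)
      then show "y j \<le> sup (y i) ?X"
      proof cases
        case 1
        then have "sup (y j) (x i) = y i"
          using up i j by (simp add: transposes_up_iff)
        then have "y j \<le> y i"
          by (metis sup_ge1)
        then show ?thesis
          by (rule le_supI1)
      next
        case 3
        then have "y j = sup (y i) (x j)"
          using up i j by (simp add: transposes_up_iff)
        then show ?thesis
          using SUP_upper[OF j, of x] by (simp add: le_supI2)
      qed simp
    qed
  qed
  ultimately have "(x i, y i) \<nearrow> (?X, ?Y)"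
    by (simp add: transposes_up_iff)
  then show "?X \<prec> ?Y"
    using covers_transposes_up_iff xy i by blast
qed

text \<open>Here the pair of infima transposes up to any single \<open>(x i, y i)\<close>. Only the
  inequality \<open>y i \<le> sup ?Y (x i)\<close> needs the description of infima of chains of
  filters.\<close>

lemma lower_regular_lattice_filter:
  fixes p :: "'a::{bounded_lattice_top, distrib_lattice} lattice_filter \<times> 'a lattice_filter"
  shows "lower_regular TYPE('i::linorder) p"
  unfolding lower_regular_def
proof (intro allI impI, elim conjE)
  fix I :: "'i set" and x y :: "'i \<Rightarrow> 'a lattice_filter"
  assume "I \<noteq> {}"
    and xy: "\<forall>i\<in>I. x i \<prec> y i \<and> projective (x i, y i) p"
    and up: "\<forall>i\<in>I. \<forall>j\<in>I. i < j \<longrightarrow> (x j, y j) \<nearrow> (x i, y i)"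
  let ?X = "INF i\<in>I. x i" and ?Y = "INF i\<in>I. y i"
  obtain i where i: "i \<in> I"
    using \<open>I \<noteq> {}\<close> by blast
  have le: "x j \<le> y j" if "j \<in> I" for j
    using xy that unfolding covers_def by auto
  have eq: "inf (y j) (x i) = x j" "sup (y j) (x i) = y i" if "i \<in> I" "j \<in> I" "i < j" for i j
    using up that by (simp_all add: transposes_up_iff)
  have mono: "x j \<le> x i" "y j \<le> y i" if "i \<in> I" "j \<in> I" "i \<le> j" for i j
    using eq[of i j] that by (metis inf_le2 order_refl sup_ge1 order.order_iff_strict)+
  have "inf ?Y (x i) = ?X"
  proof (rule antisym)
    show "inf ?Y (x i) \<le> ?X"
    proof (rule INF_greatest)
      fix j assume j: "j \<in> I"
      show "inf ?Y (x i) \<le> x j"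
      proof (cases "i < j")
        case True
        then have "x j = inf (y j) (x i)"
          using eq i j by simp
        then show ?thesis
          using INF_lower[OF j, of y] by (simp add: le_infI1)
      next
        case False
        then show ?thesis
          using mono(1)[OF j i] by (simp add: le_infI2)
      qed
    qed
    show "?X \<le> inf ?Y (x i)"
      using i le by (auto intro!: INF_lower INF_mono)
  qed
  moreover have "sup ?Y (x i) = y i"
  proof (rule antisym)
    show "sup ?Y (x i) \<le> y i"
      using i le by (simp add: INF_lower)
    have "y j \<le> y k \<or> y k \<le> y j" if "j \<in> I" "k \<in> I" for j k
      using mono(2) that by (meson linear)
    \<comment> \<open>Since the order is reverse inclusion and joins are intersections, it remains
      to compare a single \<open>y j\<close> at a time with \<open>x i\<close> and
      \<open>y i\<close>.\<close>
    then have Y: "elements ?Y = (\<Union>j\<in>I. elements (y j))"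
      using \<open>I \<noteq> {}\<close> by (subst elements_Inf_chain) auto
    have "c \<in> elements (y i)" if j: "j \<in> I" and c: "c \<in> elements (y j)" "c \<in> elements (x i)" for c j
    proof (cases "i < j")
      case True
      then show ?thesis
        using eq(2)[OF i j] c by (metis IntI sup_lattice_filter.rep_eq)
    next
      case False
      then have "y i \<le> y j"
        using mono(2)[OF j i] by simp
      then show ?thesis
        using c unfolding less_eq_lattice_filter.rep_eq by blast
    qed
    then show "y i \<le> sup ?Y (x i)"
      unfolding less_eq_lattice_filter.rep_eq sup_lattice_filter.rep_eq Y by blast
  qed
  ultimately have "(?X, ?Y) \<nearrow> (x i, y i)"
    by (simp add: transposes_up_iff)
  then show "?X \<prec> ?Y"
    using covers_transposes_up_iff xy i by blast
qed

theorem corollary30: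
  fixes F G :: "'a::{complete_lattice, distrib_lattice} lattice_filter"
  assumes "meet_continuous TYPE('a)"
    and "F \<prec> G"
    and "atomic_covering (F, G) \<or> quasi_atomic_covering (F, G)"
  shows "regular TYPE('i::linorder) (F, G)"
proof -
  obtain a H where proj: "projective (F, G) (principal_filter a, H)"
    and mbf: "atomic_mbf (a, H) \<or> quasi_atomic_mbf (a, H)"
    using assms(3) unfolding atomic_covering_def quasi_atomic_covering_def by blast
  have lt: "principal_filter a < H"
    using mbf unfolding atomic_mbf_def quasi_atomic_mbf_def maximal_based_filter_def covers_def
    by auto
  obtain y where y: "y \<in> elements H" "\<And>z. a < z \<Longrightarrow> z \<le> y \<Longrightarrow> z \<in> elements H"
    using mbf
  proof
    assume "atomic_mbf (a, H)"
    then show thesis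
      by (rule atomic_mbf_generator) (rule that)
  next
    assume "quasi_atomic_mbf (a, H)"
    then show thesis
      using that unfolding quasi_atomic_mbf_def by auto
  qed
  \<comment> \<open>Projectivity moves the ideal of \<open>(F, G)\<close> to the based filter, where
    closure under suprema is known.\<close>
  have ideal: "inf c G \<le> F \<longleftrightarrow> inf c H \<le> principal_filter a" for c
    using projective_inf_le_iff[OF proj] by simp
  have "upper_regular TYPE('i) (F, G)"
    by (rule upper_regularI) (simp add: ideal inf_SUP_le_principal_filter[OF assms(1) lt y])
  then show ?thesis
    unfolding regular_def by (simp add: lower_regular_lattice_filter)
qed

end
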